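(* There is a constant $c$ such that the following holds: if $M$ is an ordered matching on $2m$ vertices with interval chromatic number $2$ chosen uniformly at random, then $r_<(M,K_3)\le c\,m^{24/13}$ with high probability (i.e., with probability tending to $1$ as $m\to\infty$).
   Context: An ordered graph on $[N]$ is a graph with vertex set $\{1,\dots,N\}$ equipped with the natural order. Given a red/blue coloring of the edges of the complete graph on $[N]$, a red (ordered) copy of an ordered graph $G$ on $[p]$ is a strictly increasing map $\varphi:[p]\to[N]$ such that $\varphi(u)\varphi(v)$ is red for every edge $uv$ of $G$. The ordered Ramsey number $r_<(G,K_3)$ is the smallest $N$ such that every red/blue coloring of the edges of the complete graph on $[N]$ contains either a red ordered copy of $G$ or a blue triangle. The interval chromatic number of an ordered graph is the minimum number of contiguous intervals into which its vertex set can be split so that each interval is an independent set. Thus an ordered (perfect) matching on $[2m]$ with interval chromatic number $2$ is one in which every edge joins $[1,m]$ to $[m+1,2m]$; there are $m!$ such matchings, and uniform choice is among these. *)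

theory Defs
  imports Complex_Main "HOL-Combinatorics.Permutations"
begin

text \<open>An ordered graph on [p] = {1..p} is given by its edge set E, a set of
  two-element subsets of {1..p}. A red/blue colouring of the complete graph on [N]
  is given by the set R of red edges (2-subsets of {1..N}); all other pairs are blue.\<close>

definition red_ordered_copy :: "nat \<Rightarrow> nat set set \<Rightarrow> nat \<Rightarrow> nat set set \<Rightarrow> bool" where
  "red_ordered_copy p E N R \<longleftrightarrow>
     (\<exists>\<phi>. (\<forall>u\<in>{1..p}. \<phi> u \<in> {1..N}) \<and> strict_mono_on {1..p} \<phi> \<and>
          (\<forall>e\<in>E. \<phi> ` e \<in> R))"

definition blue_triangle :: "nat \<Rightarrow> nat set set \<Rightarrow> bool" where
  "blue_triangle N R \<longleftrightarrow>
     (\<exists>a b c. 1 \<le> a \<and> a < b \<and> b < c \<and> c \<le> N \<and>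
        {a, b} \<notin> R \<and> {b, c} \<notin> R \<and> {a, c} \<notin> R)"

definition ord_ramsey_K3 :: "nat \<Rightarrow> nat set set \<Rightarrow> nat" where
  "ord_ramsey_K3 p E =
     (LEAST N. \<forall>R. R \<subseteq> {e. \<exists>a b. e = {a, b} \<and> 1 \<le> a \<and> a < b \<and> b \<le> N} \<longrightarrow>
                  red_ordered_copy p E N R \<or> blue_triangle N R)"

text \<open>The ordered perfect matching on [2m] with interval chromatic number 2 determined
  by a permutation \<sigma> of {1..m}: vertex i in [1,m] is matched to m + \<sigma> i.
  This is a bijection between permutations of {1..m} and such matchings.\<close>
definition icn2_matching :: "nat \<Rightarrow> (nat \<Rightarrow> nat) \<Rightarrow> nat set set" where
  "icn2_matching m \<sigma> = {{i, m + \<sigma> i} | i. i \<in> {1..m}}"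

end

(* In a colouring without red copy and blue triangle, every blue neighbourhood is a red clique, hence has
   fewer than 2m vertices.  Cut both halves of the matching into windows of t ~ m^(4/13)
   consecutive vertices.  A random matching has at most three edges between any two windows
   (first moment over 4-subsets).  Every window is embedded as a block of t consecutive vertices
   with a common random shift in a range of size S = t k with k ~ m^(11/13).  If the right
   windows are such that, averaged over the shifts, each of them meets few blue edges, then an
   exponential moment bound gives left shifts for which every right window has a shift avoiding
   all its blue edges.  A right window failing the average condition gets 2 m t more room, which
   works unconditionally; by counting blue edges only O(m^2 / (t^2 k)) windows fail, and they cost
   O(m^3 / (t k)) = O(m^(24/13)) room in total. *)
theory Submission
  imports Defs "HOL-Library.FuncSet" "HOL-Library.Infinite_Set" "HOL-Real_Asymp.Real_Asymp"
begin

section \<open>Random choice of shifts by exponential moments\<close>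

text \<open>Choose the \<open>s u\<close> independently and uniformly. For each \<open>w\<close> the
  sum has mean at most S/8, so its exponential moment at rate \<open>l\<close> is at most
  exp(l*S/4). Markov's inequality bounds the chance of reaching S by exp(-3*l*S/4), and
  \<open>tail\<close> is the union bound over G.\<close>

lemma exists_choice_sums_below:
  fixes F :: "'w \<Rightarrow> nat \<Rightarrow> nat \<Rightarrow> real"
  assumes "finite G" "0 < S" "0 < K"
    and nonneg: "\<And>w u a. 0 \<le> F w u a"
    and bound: "\<And>w u a. F w u a \<le> K"
    and mean: "\<And>w. w \<in> G \<Longrightarrow> 8 * (\<Sum>u<n. \<Sum>a<S. F w u a) \<le> real S ^ 2"
    and tail: "real (card G) * exp (- (3 * real S / (8 * K))) < 1"
  shows "\<exists>s. (\<forall>u<n. s u < S) \<and> (\<forall>w\<in>G. (\<Sum>u<n. F w u (s u)) < real S)"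
proof (rule ccontr)
  assume contra: "\<not> ?thesis"
  \<comment> \<open>The largest rate for which l * F stays in [0, 1/2], where exp x \<le> 1 + 2 *
    x.\<close>
  define l where "l = 1 / (2 * K)"
  have l: "l > 0" using assms by (simp add: l_def)
  define P where "P = PiE {..<n} (\<lambda>_. {..<S})"
  have fP: "finite P" unfolding P_def by (intro finite_PiE) auto
  have cP: "real (card P) = real S ^ n" by (simp add: P_def card_PiE)
  have exp_moment: "(\<Sum>s\<in>P. exp (l * (\<Sum>u<n. F w u (s u)))) \<le> real S ^ n * exp (l * S / 4)"
    if w: "w \<in> G" for w
  proof -
    define T where "T u = (\<Sum>a<S. F w u a)" for u
    have T0: "T u \<ge> 0" for u unfolding T_def by (intro sum_nonneg nonneg)
    have row: "(\<Sum>a<S. exp (l * F w u a)) \<le> real S * exp (2 * l * T u / S)" for u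
    proof -
      have "(\<Sum>a<S. exp (l * F w u a)) \<le> (\<Sum>a<S. 1 + 2 * (l * F w u a))"
      proof (intro sum_mono real_exp_bound_lemma)
        fix a
        show "0 \<le> l * F w u a" using l nonneg by simp
        have "l * F w u a \<le> l * K" using l bound by simp
        also have "\<dots> = 1/2" using \<open>0 < K\<close> by (simp add: l_def)
        finally show "l * F w u a \<le> 1/2" .
      qed
      also have "\<dots> = S * (1 + 2 * l * T u / S)"
        using \<open>0 < S\<close> by (simp add: T_def sum.distrib sum_distrib_left field_simps)
      also have "\<dots> \<le> S * exp (2 * l * T u / S)"
        by (intro mult_left_mono exp_ge_add_one_self) auto
      finally show ?thesis .
    qed
    have "(\<Sum>s\<in>P. exp (l * (\<Sum>u<n. F w u (s u)))) = (\<Sum>s\<in>P. \<Prod>u<n. exp (l * F w u (s u)))"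
      by (simp add: exp_sum sum_distrib_left)
    also have "\<dots> = (\<Prod>u<n. \<Sum>a<S. exp (l * F w u a))"
      unfolding P_def by (rule prod_sum_PiE [symmetric]) auto
    also have "\<dots> \<le> (\<Prod>u<n. real S * exp (2 * l * T u / S))"
      by (intro prod_mono conjI row sum_nonneg) auto
    also have "\<dots> = real S ^ n * exp (2 * l / S * (\<Sum>u<n. T u))"
      by (simp add: prod.distrib exp_sum sum_distrib_left)
    also have "\<dots> \<le> real S ^ n * exp (l * S / 4)"
    proof -
      have "2 * l / S * (\<Sum>u<n. T u) \<le> 2 * l / S * (real S ^ 2 / 8)"
        using mean[OF w] l by (intro mult_left_mono) (auto simp: T_def)
      also have "\<dots> = l * S / 4" using \<open>0 < S\<close> by (simp add: power2_eq_square)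
      finally show ?thesis by (intro mult_left_mono) auto
    qed
    finally show ?thesis .
  qed
  \<comment> \<open>Markov and union bound in counting form: if every choice fails at some
    \<open>w\<close>, each contributes at least 1 to the total of the exponentials of the excess
    over S.\<close>
  have "real S ^ n = (\<Sum>s\<in>P. 1)" using cP by simp
  also have "\<dots> \<le> (\<Sum>s\<in>P. \<Sum>w\<in>G. exp (l * ((\<Sum>u<n. F w u (s u)) - S)))"
  proof (rule sum_mono)
    fix s assume "s \<in> P"
    then have "\<forall>u<n. s u < S" by (auto simp: P_def PiE_def Pi_def)
    then obtain w where w: "w \<in> G" "(\<Sum>u<n. F w u (s u)) \<ge> real S"
      using contra by (meson not_le)
    then have "1 \<le> exp (l * ((\<Sum>u<n. F w u (s u)) - S))"
      using l by simp
    also have "\<dots> \<le> (\<Sum>w\<in>G. exp (l * ((\<Sum>u<n. F w u (s u)) - S)))"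
      by (rule member_le_sum) (use w assms in auto)
    finally show "1 \<le> (\<Sum>w\<in>G. exp (l * ((\<Sum>u<n. F w u (s u)) - S)))" .
  qed
  also have "\<dots> = (\<Sum>w\<in>G. exp (- l * S) * (\<Sum>s\<in>P. exp (l * (\<Sum>u<n. F w u (s u)))))"
    by (subst sum.swap) (simp add: sum_distrib_left right_diff_distrib exp_diff exp_minus field_simps)
  also have "\<dots> \<le> (\<Sum>w\<in>G. exp (- l * S) * (real S ^ n * exp (l * S / 4)))"
    by (intro sum_mono mult_left_mono exp_moment) auto
  also have "\<dots> = real S ^ n * (real (card G) * exp (- l * S + l * S / 4))"
    by (simp add: exp_add [symmetric] mult_exp_exp)
  also have "- l * S + l * S / 4 = - (3 * real S / (8 * K))"
    using \<open>0 < K\<close> by (simp add: l_def field_simps)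
  also have "real S ^ n * (real (card G) * exp (- (3 * real S / (8 * K)))) < real S ^ n * 1"
    using tail \<open>0 < S\<close> by (intro mult_strict_left_mono) auto
  finally show False by simp
qed

section \<open>Edges of a random matching between two windows\<close>

text \<open>Composing with the inverse of one such permutation \<open>q\<close> injects all of them
  into the permutations of A - I. If there is no \<open>q\<close>, as for non-injective
  \<open>f\<close>, the count is 0.\<close>

lemma card_permutes_fixing_values:
  fixes f :: "'a \<Rightarrow> 'a"
  assumes "finite A" "I \<subseteq> A"
  shows "card {p. p permutes A \<and> (\<forall>i\<in>I. p i = f i)} \<le> fact (card A - card I)"
proof (cases "\<exists>q. q permutes A \<and> (\<forall>i\<in>I. q i = f i)")
  case True
  then obtain q where q: "q permutes A" "\<And>i. i \<in> I \<Longrightarrow> q i = f i" by blast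
  have "(\<lambda>p. inv q \<circ> p) ` {p. p permutes A \<and> (\<forall>i\<in>I. p i = f i)} \<subseteq> {p. p permutes (A - I)}"
  proof clarify
    fix p assume p: "p permutes A" "\<forall>i\<in>I. p i = f i"
    show "(inv q \<circ> p) permutes (A - I)"
    proof (rule permutes_superset)
      show "(inv q \<circ> p) permutes A" using p q by (simp add: permutes_compose permutes_inv)
      show "(inv q \<circ> p) x = x" if "x \<in> A - (A - I)" for x
        using that p q permutes_inverses(2)[OF q(1), of x] by auto
    qed
  qed
  moreover have "inj_on (\<lambda>p. inv q \<circ> p) X" for X
    by (rule inj_onI) (metis comp_assoc permutes_inv_o(1)[OF q(1)] id_comp)
  ultimately have "card {p. p permutes A \<and> (\<forall>i\<in>I. p i = f i)} \<le> card {p. p permutes (A - I)}"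
    using assms by (intro card_inj_on_le) (auto intro: finite_permutations)
  also have "\<dots> = fact (card A - card I)"
    using assms by (subst card_permutations) (auto simp: card_Diff_subset finite_subset)
  finally show ?thesis .
next
  case False
  then have "{p. p permutes A \<and> (\<forall>i\<in>I. p i = f i)} = {}" by blast
  then show ?thesis by (simp only: card.empty)
qed

lemma card_permutes_image_subset:
  assumes "finite A" "I \<subseteq> A" "finite J"
  shows "card {p. p permutes A \<and> p ` I \<subseteq> J} \<le> card J ^ card I * fact (card A - card I)"
proof -
  have fI: "finite I" using assms finite_subset by blast
  have "{p. p permutes A \<and> p ` I \<subseteq> J} \<subseteq>
      (\<Union>f\<in>PiE I (\<lambda>_. J). {p. p permutes A \<and> (\<forall>i\<in>I. p i = f i)})"
  proof clarify
    fix p assume "p permutes A" "p ` I \<subseteq> J"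
    then show "p \<in> (\<Union>f\<in>PiE I (\<lambda>_. J). {p. p permutes A \<and> (\<forall>i\<in>I. p i = f i)})"
      by (intro UN_I[of "restrict p I"]) auto
  qed
  then have "card {p. p permutes A \<and> p ` I \<subseteq> J} \<le>
      card (\<Union>f\<in>PiE I (\<lambda>_. J). {p. p permutes A \<and> (\<forall>i\<in>I. p i = f i)})"
    using assms fI by (intro card_mono finite_UN_I finite_PiE) (auto intro: finite_subset[OF _ finite_permutations])
  also have "\<dots> \<le> (\<Sum>f\<in>PiE I (\<lambda>_. J). card {p. p permutes A \<and> (\<forall>i\<in>I. p i = f i)})"
    by (rule card_UN_le) (use assms fI in \<open>auto intro: finite_PiE\<close>)
  also have "\<dots> \<le> (\<Sum>f\<in>PiE I (\<lambda>_. J). fact (card A - card I))"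
    by (intro sum_mono card_permutes_fixing_values assms)
  also have "\<dots> = card J ^ card I * fact (card A - card I)"
    using fI by (simp add: card_PiE)
  finally show ?thesis .
qed

text \<open>The windows are the fibres of \<open>div t\<close>. Vertices start at 1, so for t > 0
  window 0 has at most t - 1 of them, and the last index is \<open>m div t\<close>.\<close>

definition spread :: "nat \<Rightarrow> nat \<Rightarrow> nat \<Rightarrow> (nat \<Rightarrow> nat) \<Rightarrow> bool" where
  "spread C t m p \<longleftrightarrow> (\<forall>u w. card {i\<in>{1..m}. i div t = u \<and> p i div t = w} \<le> C)"

lemma card_div_eq_le:
  fixes X :: "nat set"
  assumes "0 < t"
  shows "finite {i\<in>X. i div t = u}" "card {i\<in>X. i div t = u} \<le> t"
proof -
  have "{i\<in>X. i div t = u} \<subseteq> {u * t..<u * t + t}"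
    using assms by (auto simp: dividend_less_div_times add.commute)
  then show "finite {i\<in>X. i div t = u}" "card {i\<in>X. i div t = u} \<le> t"
    using card_mono[of "{u * t..<u * t + t}"] by (auto simp: finite_subset)
qed

text \<open>First moment count: fix the two windows, then Suc C left ends, then their images in the
  right window; the other m - Suc C values can be completed in at most
  \<open>fact (m - Suc C)\<close> ways.\<close>

lemma card_not_spread_le:
  assumes "0 < t"
  shows "card {p. p permutes {1..m} \<and> \<not> spread C t m p}
           \<le> (m div t + 1)\<^sup>2 * t ^ (2 * Suc C) * fact (m - Suc C)"
proof -
  let ?n = "m div t + 1"
  define Win where "Win u = {i\<in>{1..m}. i div t = u}" for u
  define Subs where "Subs u = {I. I \<subseteq> Win u \<and> card I = Suc C}" for u
  define Q where "Q w I = {p. p permutes {1..m} \<and> p ` I \<subseteq> Win w}" for w I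
  have Win: "finite (Win u)" "card (Win u) \<le> t" "Win u \<subseteq> {1..m}" for u
    using card_div_eq_le[OF assms, of "{1..m}" u] by (auto simp: Win_def)
  have finSubs: "finite (Subs u)" for u
    by (rule finite_subset[of _ "Pow (Win u)"]) (use Win in \<open>auto simp: Subs_def\<close>)
  have cSubs: "card (Subs u) \<le> t ^ Suc C" for u
  proof -
    have "card (Subs u) = card (Win u) choose Suc C"
      unfolding Subs_def by (rule n_subsets) (rule Win)
    also have "\<dots> \<le> card (Win u) ^ Suc C"
    proof (cases "Suc C \<le> card (Win u)")
      case True then show ?thesis by (rule binomial_le_pow)
    qed (simp add: binomial_eq_0)
    also have "\<dots> \<le> t ^ Suc C" using Win by (intro power_mono) auto
    finally show ?thesis .
  qed
  have finQ: "finite (Q w I)" for w I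
    unfolding Q_def by (rule finite_subset[OF _ finite_permutations[of "{1..m}"]]) auto
  have cQ: "card (Q w I) \<le> t ^ Suc C * fact (m - Suc C)" if "I \<in> Subs u" for w I u
  proof -
    have I: "I \<subseteq> {1..m}" "card I = Suc C" using that Win(3)[of u] by (auto simp: Subs_def)
    have "card (Q w I) \<le> card (Win w) ^ card I * fact (card {1..m} - card I)"
      unfolding Q_def by (rule card_permutes_image_subset[OF _ I(1) Win(1)]) simp
    also have "\<dots> \<le> t ^ Suc C * fact (m - Suc C)"
      unfolding I(2) using Win by (intro mult_mono power_mono) auto
    finally show ?thesis .
  qed
  have "{p. p permutes {1..m} \<and> \<not> spread C t m p} \<subseteq> (\<Union>u<?n. \<Union>w<?n. \<Union>I\<in>Subs u. Q w I)"
  proof clarify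
    fix p assume p: "p permutes {1..m}" "\<not> spread C t m p"
    then obtain u w where uw: "Suc C \<le> card {i\<in>{1..m}. i div t = u \<and> p i div t = w}" (is "_ \<le> card ?X")
      by (auto simp: spread_def not_le Suc_le_eq)
    then obtain I where I: "I \<subseteq> ?X" "card I = Suc C"
      by (meson obtain_subset_with_card_n)
    have "I \<noteq> {}" using I by auto
    then obtain i where i: "i \<in> I" by blast
    have "i div t = u" "p i div t = w" "i \<le> m" using i I by auto
    moreover have "p i \<le> m" using i I permutes_in_image[OF p(1), of i] by auto
    ultimately have "u < ?n" "w < ?n" by (auto simp: div_le_mono less_Suc_eq_le)
    moreover have "I \<in> Subs u" using I by (auto simp: Subs_def Win_def)
    moreover have "p \<in> Q w I"
      using I p(1) permutes_in_image[OF p(1)] by (fastforce simp: Q_def Win_def)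
    ultimately show "p \<in> (\<Union>u<?n. \<Union>w<?n. \<Union>I\<in>Subs u. Q w I)" by blast
  qed
  then have "card {p. p permutes {1..m} \<and> \<not> spread C t m p}
      \<le> card (\<Union>u<?n. \<Union>w<?n. \<Union>I\<in>Subs u. Q w I)"
    by (intro card_mono finite_UN_I finSubs finQ) auto
  also have "\<dots> \<le> (\<Sum>u<?n. card (\<Union>w<?n. \<Union>I\<in>Subs u. Q w I))"
    by (rule card_UN_le) auto
  also have "\<dots> \<le> (\<Sum>u<?n. \<Sum>w<?n. card (\<Union>I\<in>Subs u. Q w I))"
    by (intro sum_mono card_UN_le) auto
  also have "\<dots> \<le> (\<Sum>u<?n. \<Sum>w<?n. \<Sum>I\<in>Subs u. card (Q w I))"
    by (intro sum_mono card_UN_le finSubs)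
  also have "\<dots> \<le> (\<Sum>u<?n. \<Sum>w<?n. \<Sum>I\<in>Subs u. t ^ Suc C * fact (m - Suc C))"
    by (intro sum_mono cQ) auto
  also have "\<dots> = (\<Sum>u<?n. \<Sum>w<?n. card (Subs u) * (t ^ Suc C * fact (m - Suc C)))"
    by simp
  also have "\<dots> \<le> (\<Sum>u<?n. \<Sum>w<?n. t ^ Suc C * (t ^ Suc C * fact (m - Suc C)))"
    by (intro sum_mono mult_right_mono cSubs) auto
  also have "\<dots> = ?n\<^sup>2 * t ^ (2 * Suc C) * fact (m - Suc C)"
    unfolding mult_2 power_add power2_eq_square by (simp add: algebra_simps)
  finally show ?thesis .
qed

section \<open>Blue neighbourhoods\<close>

text \<open>Two blue neighbours of \<open>a\<close> joined by a blue edge would give a blue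
  triangle, so the neighbours to the right of \<open>a\<close> form a red clique. If there were p of
  them, listing them in increasing order would embed any ordered graph on p vertices.\<close>

lemma blue_degree_less:
  assumes E: "\<And>e. e \<in> E \<Longrightarrow> \<exists>u v. e = {u, v} \<and> u \<in> {1..p} \<and> v \<in> {1..p} \<and> u \<noteq> v"
    and nored: "\<not> red_ordered_copy p E N R" and noblue: "\<not> blue_triangle N R"
    and a: "a \<ge> 1"
  shows "card {b. a < b \<and> b \<le> N \<and> {a, b} \<notin> R} < p"
proof (rule ccontr)
  let ?T = "{b. a < b \<and> b \<le> N \<and> {a, b} \<notin> R}"
  assume "\<not> ?thesis"
  then have p: "p \<le> card ?T" by simp
  have "finite ?T" by (rule finite_subset[of _ "{..N}"]) auto
  then obtain h where h: "bij_betw h {..<card ?T} ?T" "strict_mono_on {..<card ?T} h"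
    by (rule ex_bij_betw_strict_mono_card)
  define f where "f u = h (u - 1)" for u
  have fin: "f u \<in> ?T" if "u \<in> {1..p}" for u
    using h(1) that p by (auto simp: f_def bij_betw_def)
  have mono: "strict_mono_on {1..p} f"
    unfolding f_def by (intro strict_mono_onI strict_mono_onD[OF h(2)]) (use p in auto)
  have edge: "{f u, f v} \<in> R" if "u \<in> {1..p}" "v \<in> {1..p}" "u < v" for u v
  proof (rule ccontr)
    assume "{f u, f v} \<notin> R"
    moreover have "f u < f v" using mono that by (simp add: strict_mono_onD)
    ultimately have "blue_triangle N R"
      using fin[OF that(1)] fin[OF that(2)] a unfolding blue_triangle_def by blast
    then show False using noblue by blast
  qed
  have "f ` e \<in> R" if "e \<in> E" for e
  proof -
    obtain u v where "e = {u, v}" "u \<in> {1..p}" "v \<in> {1..p}" "u \<noteq> v" using E[OF \<open>e \<in> E\<close>] by blast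
    then show ?thesis using edge[of u v] edge[of v u]
      by (cases "u < v") (auto simp: insert_commute)
  qed
  moreover have "f u \<in> {1..N}" if "u \<in> {1..p}" for u using fin[OF that] a by auto
  ultimately have "red_ordered_copy p E N R"
    using mono unfolding red_ordered_copy_def by blast
  then show False using nored by blast
qed

section \<open>Placing the windows\<close>

text \<open>A shift is constant within a window, so order is kept there; a shift below
  \<open>S u\<close> keeps window \<open>u\<close> inside its slot, which ends before the next one
  starts. \<open>S\<close> depends on \<open>u\<close> because right slots have two lengths.\<close>

lemma strict_mono_window_placement:
  fixes q s S :: "nat \<Rightarrow> nat"
  assumes "0 < t" and gap: "\<And>u. q u + t + S u \<le> q (Suc u)" and s: "\<And>u. u < n \<Longrightarrow> s u < S u"
    and X: "\<And>i. i \<in> X \<Longrightarrow> i div t < n"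
  shows "strict_mono_on X (\<lambda>i. q (i div t) + i mod t + s (i div t))"
proof (rule strict_mono_onI)
  fix i j assume ij: "i \<in> X" "j \<in> X" "i < j"
  show "q (i div t) + i mod t + s (i div t) < q (j div t) + j mod t + s (j div t)"
  proof (cases "i div t = j div t")
    case True
    then have "i mod t < j mod t"
      using ij(3) by (metis div_mult_mod_eq nat_add_left_cancel_less)
    with True show ?thesis by simp
  next
    case False
    then have "i div t < j div t" using ij(3) div_le_mono[of i j t] by simp
    moreover have "mono q"
      using gap by (intro mono_iff_le_Suc[THEN iffD2] allI) (meson add_leD1)
    ultimately have "q (Suc (i div t)) \<le> q (j div t)" by (simp add: monoD)
    moreover have "i mod t < t" using assms by simp
    ultimately show ?thesis using gap[of "i div t"] s[OF X[OF ij(1)]] by linarith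
  qed
qed

text \<open>Positions start at 0: left slots tile the numbers below n * L, right slots follow. The
  last term of the bound on \<open>Y\<close> is the extra room D * t times a bound on the number of
  bad right windows. \<open>spread\<close> limits both the charge per blue edge and the effect of a
  single left shift.\<close>

lemma window_placement:
  fixes \<sigma> :: "nat \<Rightarrow> nat" and bl :: "nat \<Rightarrow> nat \<Rightarrow> bool" and m t S C D :: nat
  defines "n \<equiv> m div t + 1" and "L \<equiv> t + S"
  assumes perm: "\<sigma> permutes {1..m}" and spread: "spread C t m \<sigma>"
    and pos: "0 < t" "0 < S" "0 < C" "0 < D"
    and deg: "\<And>x. finite {y. bl x y}" "\<And>x. card {y. bl x y} \<le> D"
    and tail: "real n * exp (- (3 * real S / (8 * (real C * real D)))) < 1"
  shows "\<exists>X Y. strict_mono_on {1..m} X \<and> strict_mono_on {1..m} Y \<and>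
      (\<forall>i\<in>{1..m}. X i < n * L) \<and>
      (\<forall>j\<in>{1..m}. n * L \<le> Y j \<and> Y j < 2 * (n * L) + D * t * (8 * C * (n * L) * D div S\<^sup>2)) \<and>
      (\<forall>i\<in>{1..m}. \<not> bl (X i) (Y (\<sigma> i)))"
proof -
  define X0 where "X0 i = (i div t) * L + i mod t" for i
  define I where "I w = {i\<in>{1..m}. \<sigma> i div t = w}" for w
  \<comment> \<open>The number of right shifts blocked by edge \<open>i\<close> once its left window
    is shifted by \<open>a\<close>.\<close>
  define f where "f i q a = card {b. b < S \<and> bl (X0 i + a) (q + \<sigma> i mod t + b)}" for i q a
  \<comment> \<open>The slot of a right window is \<open>L\<close> long if the window, tried at the current position,
    sees few blue edges on average over the shifts; otherwise the slot gets \<open>D * t\<close> extra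
    shifts, more than the blue neighbours of its partners can block. Trial slots are
    disjoint, so the bad ones are charged to distinct blue edges. The positions \<open>p\<close>
    depend only on these averages, hence not on the left shifts, which are chosen later.\<close>
  define cost where "cost w q = (\<Sum>i\<in>I w. \<Sum>a<S. f i q a)" for w q
  define good where "good w q \<longleftrightarrow> 8 * cost w q \<le> S\<^sup>2" for w q
  define p where "p = rec_nat (n * L) (\<lambda>w q. q + L + (if good w q then 0 else D * t))"
  have p0: "p 0 = n * L" and pSuc: "p (Suc w) = p w + L + (if good w (p w) then 0 else D * t)" for w
    by (simp_all add: p_def)
  have p_mono: "mono p" by (intro mono_iff_le_Suc[THEN iffD2] allI) (simp add: pSuc)
  define bad where "bad = {w. w < n \<and> \<not> good w (p w)}"
  define d where "d x w = card {y. bl x y \<and> p w \<le> y \<and> y < p w + L}" for x w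
  define g where "g u w = (\<Sum>x\<in>{u * L..<u * L + L}. d x w)" for u w

  have sig: "\<sigma> i \<in> {1..m}" if "i \<in> {1..m}" for i
    using perm that by (simp only: permutes_in_image)
  have div_n: "i div t < n" if "i \<in> {1..m}" for i
    using that by (auto simp: n_def less_Suc_eq_le div_le_mono)
  have finI: "finite (I w)" for w by (simp add: I_def)
  have card_block: "card {i\<in>I w. i div t = u} \<le> C" for u w
  proof -
    have "{i\<in>I w. i div t = u} = {i\<in>{1..m}. i div t = u \<and> \<sigma> i div t = w}" by (auto simp: I_def)
    then show ?thesis using spread by (simp add: spread_def)
  qed
  have cardI: "card (I w) \<le> t" for w
  proof -
    have "\<sigma> ` I w \<subseteq> {j\<in>{1..m}. j div t = w}" using sig by (auto simp: I_def)
    then have "card (\<sigma> ` I w) \<le> card {j\<in>{1..m}. j div t = w}"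
      by (intro card_mono) auto
    moreover have "card (\<sigma> ` I w) = card (I w)"
      using permutes_inj_on[OF perm] by (rule card_image)
    ultimately show ?thesis using card_div_eq_le(2)[OF pos(1), of "{1..m}" w] by simp
  qed
  have by_left: "(\<Sum>u<n. \<Sum>i\<in>{i\<in>I w. i div t = u}. h i) = (\<Sum>i\<in>I w. h i)"
    for h :: "nat \<Rightarrow> real" and w
    by (rule sum.group) (use div_n finI in \<open>auto simp: I_def\<close>)
  have by_left_nat: "(\<Sum>u<n. \<Sum>i\<in>{i\<in>I w. i div t = u}. h i) = (\<Sum>i\<in>I w. h i)"
    for h :: "nat \<Rightarrow> nat" and w
    by (rule sum.group) (use div_n finI in \<open>auto simp: I_def\<close>)
  have nbrs_le: "card {b. b < K \<and> bl x (y + b)} \<le> D" for K x y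
  proof -
    have "card {b. b < K \<and> bl x (y + b)} \<le> card {z. bl x z}"
      by (rule card_inj_on_le[of "\<lambda>b. y + b"]) (use deg in \<open>auto simp: inj_on_def\<close>)
    then show ?thesis using deg(2)[of x] by simp
  qed

  \<comment> \<open>Different shifts give different points of the left slot and of the trial slot,
    so each pair of shifts counted here is a different blue edge between these slots.\<close>
  have f_row: "(\<Sum>a<S. f i (p w) a) \<le> g (i div t) w" if "i \<in> I w" for i w
  proof -
    have mods: "i mod t < t" "\<sigma> i mod t < t" using pos by auto
    have "f i (p w) a \<le> d (X0 i + a) w" for a
      unfolding f_def d_def
      by (rule card_inj_on_le[of "\<lambda>b. p w + \<sigma> i mod t + b"])
        (use deg(1) mods in \<open>auto simp: inj_on_def L_def intro: finite_subset[OF _ deg(1)]\<close>)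
    then have "(\<Sum>a<S. f i (p w) a) \<le> (\<Sum>a<S. d (X0 i + a) w)" by (intro sum_mono)
    also have "\<dots> = (\<Sum>x\<in>(\<lambda>a. X0 i + a) ` {..<S}. d x w)"
      by (subst sum.reindex) (auto simp: inj_on_def)
    also have "\<dots> \<le> g (i div t) w"
      unfolding g_def by (rule sum_mono2) (use mods add_strict_mono[OF mods(1)] in \<open>auto simp: X0_def L_def\<close>)
    finally show ?thesis .
  qed
  \<comment> \<open>At most C matching edges join a left window to \<open>w\<close>, so each blue
    edge is charged at most C times.\<close>
  have cost_le: "cost w (p w) \<le> C * (\<Sum>x<n * L. d x w)" for w
  proof -
    have "cost w (p w) \<le> (\<Sum>i\<in>I w. g (i div t) w)"
      unfolding cost_def by (intro sum_mono f_row)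
    also have "\<dots> = (\<Sum>u<n. \<Sum>i\<in>{i\<in>I w. i div t = u}. g (i div t) w)"
      by (rule by_left_nat [symmetric])
    also have "\<dots> = (\<Sum>u<n. card {i\<in>I w. i div t = u} * g u w)"
      by (intro sum.cong) simp_all
    also have "\<dots> \<le> (\<Sum>u<n. C * g u w)"
      by (intro sum_mono mult_right_mono card_block) auto
    also have "\<dots> = C * (\<Sum>x<n * L. d x w)"
      unfolding sum_distrib_left[symmetric] g_def sum.nat_group ..
    finally show ?thesis .
  qed
  have d_sum: "(\<Sum>w<n. d x w) \<le> D" for x
  proof -
    have "(\<Sum>w<n. d x w) = card (\<Union>w<n. {y. bl x y \<and> p w \<le> y \<and> y < p w + L})"
      unfolding d_def
    proof (rule card_UN_disjoint [symmetric])
      have sep: "p v + L \<le> p w" if "v < w" for v w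
        using monoD[OF p_mono, of "Suc v" w] that pSuc[of v] by simp
      show "\<forall>v\<in>{..<n}. \<forall>w\<in>{..<n}. v \<noteq> w \<longrightarrow>
          {y. bl x y \<and> p v \<le> y \<and> y < p v + L} \<inter> {y. bl x y \<and> p w \<le> y \<and> y < p w + L} = {}"
      proof (intro ballI impI)
        fix v w :: nat assume "v \<noteq> w"
        then have "p v + L \<le> p w \<or> p w + L \<le> p v" using sep by (meson linorder_neqE_nat)
        then show "{y. bl x y \<and> p v \<le> y \<and> y < p v + L} \<inter> {y. bl x y \<and> p w \<le> y \<and> y < p w + L} = {}"
          by auto
      qed
    qed (auto intro: finite_subset[OF _ deg(1)])
    also have "\<dots> \<le> card {y. bl x y}" by (intro card_mono deg) auto
    finally show ?thesis using deg(2)[of x] by simp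
  qed
  \<comment> \<open>Double counting: a bad window costs more than S^2 / 8, while all costs together
    are at most C times the number n * L * D of blue edges available.\<close>
  have "card bad * S\<^sup>2 = (\<Sum>w\<in>bad. S\<^sup>2)" by simp
  also have "\<dots> \<le> (\<Sum>w\<in>bad. 8 * cost w (p w))"
    by (intro sum_mono) (simp add: bad_def good_def)
  also have "\<dots> \<le> (\<Sum>w<n. 8 * cost w (p w))"
    by (intro sum_mono2) (auto simp: bad_def)
  also have "\<dots> \<le> (\<Sum>w<n. 8 * (C * (\<Sum>x<n * L. d x w)))"
    by (intro sum_mono mult_left_mono cost_le) auto
  also have "\<dots> = 8 * C * (\<Sum>x<n * L. \<Sum>w<n. d x w)"
    by (subst sum.swap) (simp add: sum_distrib_left mult.assoc)
  also have "\<dots> \<le> 8 * C * (\<Sum>x<n * L. D)"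
    by (intro mult_left_mono sum_mono d_sum) auto
  also have "\<dots> = 8 * C * (n * L) * D" by simp
  finally have card_bad: "card bad \<le> 8 * C * (n * L) * D div S\<^sup>2"
    using pos by (simp add: less_eq_div_iff_mult_less_eq)

  \<comment> \<open>Edges are grouped by left window since they share its random shift; at most C
    edges with at most D blocked shifts each give K = C * D.\<close>
  define F where "F w u a = (\<Sum>i\<in>{i\<in>I w. i div t = u}. real (f i (p w) a))" for w u a
  have "\<exists>s. (\<forall>u<n. s u < S) \<and> (\<forall>w\<in>{..<n} - bad. (\<Sum>u<n. F w u (s u)) < real S)"
  proof (rule exists_choice_sums_below[where K = "real C * real D"])
    show "F w u a \<le> real C * real D" for w u a
    proof -
      have "F w u a \<le> (\<Sum>i\<in>{i\<in>I w. i div t = u}. real D)"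
        unfolding F_def f_def by (intro sum_mono of_nat_mono nbrs_le)
      also have "\<dots> = real (card {i\<in>I w. i div t = u}) * real D" by simp
      also have "\<dots> \<le> real C * real D"
        by (intro mult_right_mono of_nat_mono card_block) auto
      finally show ?thesis .
    qed
    \<comment> \<open>The factor 8 in \<open>good\<close> was chosen to match this hypothesis on the
      mean.\<close>
    show "8 * (\<Sum>u<n. \<Sum>a<S. F w u a) \<le> real S ^ 2" if "w \<in> {..<n} - bad" for w
    proof -
      have "(\<Sum>u<n. \<Sum>a<S. F w u a) = (\<Sum>a<S. \<Sum>i\<in>I w. real (f i (p w) a))"
        by (subst sum.swap) (simp add: F_def by_left)
      also have "\<dots> = real (cost w (p w))"
        by (subst sum.swap) (simp add: cost_def)
      finally have "(\<Sum>u<n. \<Sum>a<S. F w u a) = real (cost w (p w))" .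
      moreover have "real (8 * cost w (p w)) \<le> real (S\<^sup>2)"
        using that by (intro of_nat_mono) (simp add: bad_def good_def)
      ultimately show ?thesis by simp
    qed
    have "card ({..<n} - bad) \<le> n"
      using card_mono[of "{..<n}" "{..<n} - bad"] by simp
    then have "real (card ({..<n} - bad)) * exp (- (3 * real S / (8 * (real C * real D))))
        \<le> real n * exp (- (3 * real S / (8 * (real C * real D))))"
      by (intro mult_right_mono) auto
    then show "real (card ({..<n} - bad)) * exp (- (3 * real S / (8 * (real C * real D)))) < 1"
      using tail by linarith
  qed (use pos in \<open>auto simp: F_def intro: sum_nonneg\<close>)
  then obtain s where s: "\<And>u. u < n \<Longrightarrow> s u < S"
      "\<And>w. w < n \<Longrightarrow> w \<notin> bad \<Longrightarrow> (\<Sum>u<n. F w u (s u)) < real S"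
    by auto
  \<comment> \<open>The number of shifts that the actual slot of \<open>w\<close> admits.\<close>
  define Sw where "Sw w = (if good w (p w) then S else S + D * t)" for w
  define X where "X i = (i div t) * L + i mod t + s (i div t)" for i
  \<comment> \<open>Otherwise the blocked shifts would cover the whole range. A good window has
    fewer than S of them by the choice of \<open>s\<close>; a bad one has at most t * D, since it
    meets at most t edges, against S + D * t shifts.\<close>
  have "\<exists>b<Sw w. \<forall>i\<in>I w. \<not> bl (X i) (p w + \<sigma> i mod t + b)" if w: "w < n" for w
  proof (rule ccontr)
    let ?B = "\<lambda>i. {b. b < Sw w \<and> bl (X i) (p w + \<sigma> i mod t + b)}"
    assume "\<not> ?thesis"
    then have "{..<Sw w} \<subseteq> (\<Union>i\<in>I w. ?B i)" by auto
    then have "card {..<Sw w} \<le> card (\<Union>i\<in>I w. ?B i)"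
      by (intro card_mono finite_UN_I finI) auto
    also have "\<dots> \<le> (\<Sum>i\<in>I w. card (?B i))" by (rule card_UN_le) (rule finI)
    also have "\<dots> < Sw w"
    proof (cases "good w (p w)")
      case True
      have "(\<Sum>u<n. F w u (s u)) = (\<Sum>u<n. \<Sum>i\<in>{i\<in>I w. i div t = u}. real (f i (p w) (s (i div t))))"
        unfolding F_def by (intro sum.cong) auto
      also have "\<dots> = real (\<Sum>i\<in>I w. card (?B i))"
        unfolding by_left using True by (simp add: f_def X0_def X_def Sw_def)
      finally have "real (\<Sum>i\<in>I w. card (?B i)) < real S"
        using s(2)[OF w] True by (simp add: bad_def)
      then show ?thesis using True by (simp only: of_nat_less_iff Sw_def if_True)
    next
      case False
      have "(\<Sum>i\<in>I w. card (?B i)) \<le> card (I w) * D"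
        by (rule sum_bounded_above[where 'a = nat, unfolded of_nat_id]) (rule nbrs_le)
      also have "\<dots> \<le> t * D" using cardI by (intro mult_right_mono) auto
      also have "\<dots> < Sw w" using False pos by (simp add: Sw_def)
      finally show ?thesis .
    qed
    finally show False by simp
  qed
  then obtain s' where s': "\<And>w. w < n \<Longrightarrow> s' w < Sw w"
      "\<And>w i. w < n \<Longrightarrow> i \<in> I w \<Longrightarrow> \<not> bl (X i) (p w + \<sigma> i mod t + s' w)"
    by metis
  define Y where "Y j = p (j div t) + j mod t + s' (j div t)" for j
  have mono_X: "strict_mono_on {1..m} X"
    unfolding X_def
    by (rule strict_mono_window_placement[where S = "\<lambda>_. S" and n = n])
      (use pos s div_n in \<open>auto simp: L_def\<close>)
  have mono_Y: "strict_mono_on {1..m} Y"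
    unfolding Y_def
    by (rule strict_mono_window_placement[where S = Sw and n = n])
      (use pos s' div_n in \<open>auto simp: L_def Sw_def pSuc\<close>)
  have X_less: "X i < n * L" if "i \<in> {1..m}" for i
  proof -
    have "i mod t < t" using pos by simp
    then have "X i < Suc (i div t) * L" using s(1)[OF div_n[OF that]] by (simp add: X_def L_def)
    also have "\<dots> \<le> n * L" using div_n[OF that] by (intro mult_right_mono) auto
    finally show ?thesis .
  qed
  have Y_range: "n * L \<le> Y j \<and> Y j < 2 * (n * L) + D * t * (8 * C * (n * L) * D div S\<^sup>2)"
    if "j \<in> {1..m}" for j
  proof
    have "p 0 \<le> p (j div t)" by (intro monoD[OF p_mono]) simp
    then show "n * L \<le> Y j" by (simp add: p0 Y_def)
    have p_eq: "p w = n * L + w * L + D * t * card {v. v < w \<and> \<not> good v (p v)}" for w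
    proof (induction w)
      case (Suc w)
      have "{v. v < Suc w \<and> \<not> good v (p v)} =
          (if good w (p w) then {} else {w}) \<union> {v. v < w \<and> \<not> good v (p v)}"
        by (auto simp: less_Suc_eq)
      then show ?case using Suc by (simp add: pSuc)
    qed (simp add: p0)
    have "j mod t < t" using pos by simp
    then have "Y j < p (Suc (j div t))"
      using s'(1)[OF div_n[OF that]] by (simp add: Y_def pSuc Sw_def L_def split: if_splits)
    also have "\<dots> \<le> p n" using div_n[OF that] by (intro monoD[OF p_mono]) simp
    also have "\<dots> = 2 * (n * L) + D * t * card bad" by (simp add: p_eq[of n] bad_def)
    also have "\<dots> \<le> 2 * (n * L) + D * t * (8 * C * (n * L) * D div S\<^sup>2)"
      using card_bad by simp
    finally show "Y j < 2 * (n * L) + D * t * (8 * C * (n * L) * D div S\<^sup>2)" .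
  qed
  have red: "\<not> bl (X i) (Y (\<sigma> i))" if "i \<in> {1..m}" for i
    using s'(2)[of "\<sigma> i div t" i] div_n[OF sig[OF that]] that by (simp add: Y_def I_def)
  show ?thesis
    by (intro exI[of _ X] exI[of _ Y] conjI ballI mono_X mono_Y X_less red
        Y_range[THEN conjunct1] Y_range[THEN conjunct2])
qed

text \<open>In a colouring without either structure, blue forward degrees are at most D = 2 * m, so
  \<open>window_placement\<close> yields a red copy after all: \<open>X\<close> places the first
  half and \<open>Y\<close> the second.\<close>

lemma ord_ramsey_icn2_matching_le:
  fixes m t S C :: nat
  defines "n \<equiv> m div t + 1" and "L \<equiv> t + S"
  assumes perm: "\<sigma> permutes {1..m}" and spread: "spread C t m \<sigma>"
    and pos: "0 < t" "0 < S" "0 < C" "0 < m"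
    and tail: "real n * exp (- (3 * real S / (8 * (real C * real (2 * m))))) < 1"
  shows "ord_ramsey_K3 (2 * m) (icn2_matching m \<sigma>)
           \<le> 2 * (n * L) + 2 * m * t * (8 * C * (n * L) * (2 * m) div S\<^sup>2)" (is "_ \<le> ?N")
  unfolding ord_ramsey_K3_def
proof (intro Least_le allI impI)
  fix R assume "R \<subseteq> {e. \<exists>a b. e = {a, b} \<and> 1 \<le> a \<and> a < b \<and> b \<le> ?N}"
  show "red_ordered_copy (2 * m) (icn2_matching m \<sigma>) ?N R \<or> blue_triangle ?N R"
  proof (rule ccontr)
    assume contra: "\<not> ?thesis"
    have sig: "\<sigma> i \<in> {1..m}" if "i \<in> {1..m}" for i
      using perm that by (simp only: permutes_in_image)
    \<comment> \<open>\<open>Suc\<close> translates positions from 0 to vertices from 1. Forward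
      pairs suffice because every left position lies below every right one.\<close>
    define bl where "bl x y \<longleftrightarrow> x < y \<and> y < ?N \<and> {Suc x, Suc y} \<notin> R" for x y
    have fin: "finite {y. bl x y}" for x
      by (rule finite_subset[of _ "{..<?N}"]) (auto simp: bl_def)
    have deg: "card {y. bl x y} \<le> 2 * m" for x
    proof -
      have "card {y. bl x y} = card (Suc ` {y. bl x y})"
        by (simp add: card_image)
      also have "\<dots> \<le> card {b. Suc x < b \<and> b \<le> ?N \<and> {Suc x, b} \<notin> R}"
      proof (rule card_mono)
        show "finite {b. Suc x < b \<and> b \<le> ?N \<and> {Suc x, b} \<notin> R}"
          by (rule finite_subset[of _ "{..?N}"]) auto
      qed (auto simp: bl_def)
      also have "\<dots> < 2 * m"
      proof (rule blue_degree_less)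
        fix e assume "e \<in> icn2_matching m \<sigma>"
        then obtain i where i: "e = {i, m + \<sigma> i}" "i \<in> {1..m}"
          by (auto simp: icn2_matching_def)
        then show "\<exists>u v. e = {u, v} \<and> u \<in> {1..2 * m} \<and> v \<in> {1..2 * m} \<and> u \<noteq> v"
          using sig[OF i(2)] by (intro exI[of _ i] exI[of _ "m + \<sigma> i"]) auto
      qed (use contra in auto)
      finally show ?thesis by simp
    qed
    obtain X Y where XY: "strict_mono_on {1..m} X" "strict_mono_on {1..m} Y"
      and X: "\<And>i. i \<in> {1..m} \<Longrightarrow> X i < n * L"
      and Y: "\<And>j. j \<in> {1..m} \<Longrightarrow> n * L \<le> Y j \<and> Y j < ?N"
      and red: "\<And>i. i \<in> {1..m} \<Longrightarrow> \<not> bl (X i) (Y (\<sigma> i))"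
      using window_placement[where bl = bl and D = "2 * m", OF perm spread pos(1-3) _ fin deg,
          folded n_def L_def] pos(4) tail
      by (simp only: mult_pos_pos zero_less_numeral) blast
    define \<phi> where "\<phi> u = (if u \<le> m then Suc (X u) else Suc (Y (u - m)))" for u
    have "strict_mono_on {1..2 * m} \<phi>"
    proof (rule strict_mono_onI)
      fix u v assume uv: "u \<in> {1..2 * m}" "v \<in> {1..2 * m}" "u < v"
      consider "v \<le> m" | "u \<le> m" "m < v" | "m < u" by linarith
      then show "\<phi> u < \<phi> v"
      proof cases
        case 1
        then show ?thesis using strict_mono_onD[OF XY(1), of u v] uv by (simp add: \<phi>_def)
      next
        case 2
        then have "v - m \<in> {1..m}" using uv(2) by auto
        with 2 have "X u < n * L" "n * L \<le> Y (v - m)" using X[of u] Y[of "v - m"] uv by auto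
        with 2 show ?thesis by (simp add: \<phi>_def)
      next
        case 3
        then show ?thesis using strict_mono_onD[OF XY(2), of "u - m" "v - m"] uv by (simp add: \<phi>_def)
      qed
    qed
    moreover have "\<phi> u \<in> {1..?N}" if u: "u \<in> {1..2 * m}" for u
    proof (cases "u \<le> m")
      case True
      then show ?thesis using X[of u] u by (simp add: \<phi>_def)
    next
      case False
      then have "u - m \<in> {1..m}" using u by auto
      then show ?thesis using Y[of "u - m"] False by (simp add: \<phi>_def)
    qed
    moreover have "\<phi> ` e \<in> R" if e: "e \<in> icn2_matching m \<sigma>" for e
    proof -
      obtain i where i: "e = {i, m + \<sigma> i}" "i \<in> {1..m}"
        using e by (auto simp: icn2_matching_def)
      have "X i < Y (\<sigma> i)" "Y (\<sigma> i) < ?N"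
        using X[OF i(2)] Y[OF sig[OF i(2)]] by auto
      then have "{Suc (X i), Suc (Y (\<sigma> i))} \<in> R" using red[OF i(2)] by (simp add: bl_def)
      then show ?thesis using i sig[OF i(2)] by (simp add: \<phi>_def insert_commute)
    qed
    ultimately have "red_ordered_copy (2 * m) (icn2_matching m \<sigma>) ?N R"
      unfolding red_ordered_copy_def by blast
    then show False using contra by blast
  qed
qed

section \<open>Numerical estimates and the limit\<close>

lemma power_mult_fact_le_fact: "a ^ j * fact a \<le> (fact (a + j) :: nat)"
proof (induction j)
  case (Suc j)
  have "a ^ Suc j * fact a = a * (a ^ j * fact a)" by simp
  also have "\<dots> \<le> (a + j + 1) * fact (a + j)" using Suc by (intro mult_mono) auto
  finally show ?case by simp
qed simp

text \<open>Regular slots take O(m * k) room and bad windows O(m^3 / (t * k)); both are of order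
  m^(24/13). The constant is 400 = 2 * 8 + 384.\<close>

lemma placement_length_bound:
  fixes m t k :: nat
  defines "n \<equiv> m div t + 1" and "S \<equiv> t * k"
  defines "L \<equiv> t + S"
  assumes m: "1 \<le> m" and t: "1 \<le> t" "t \<le> m" and k: "1 \<le> k"
    and low: "real m powr (4/13) \<le> t" "real m powr (11/13) \<le> k" and up: "real k \<le> 2 * real m powr (11/13)"
  shows "real (2 * (n * L) + 2 * m * t * (8 * 3 * (n * L) * (2 * m) div S\<^sup>2)) \<le> 400 * real m powr (24/13)"
proof -
  have "n * t \<le> m + t" by (simp add: n_def algebra_simps)
  then have nt: "n * t \<le> 2 * m" using t by linarith
  have "n * L = n * t * (k + 1)" by (simp add: L_def S_def algebra_simps)
  also have "\<dots> \<le> 2 * m * (2 * k)" using k by (intro mult_mono[OF nt]) auto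
  finally have nL: "n * L \<le> 4 * m * k" by simp
  have mm: "real m * real m powr (11/13) = real m powr (24/13)"
    using m powr_add[of "real m" 1 "11/13"] by simp
  have "real (n * L) \<le> 4 * (real m * real k)" using of_nat_mono[OF nL, where 'a = real] by simp
  also have "\<dots> \<le> 4 * (real m * (2 * real m powr (11/13)))"
    using up by (intro mult_left_mono) auto
  finally have A: "real (n * L) \<le> 8 * real m powr (24/13)" using mm by simp
  have tk: "real m powr (15/13) \<le> real t * real k"
  proof -
    have "real m powr (15/13) = real m powr (4/13) * real m powr (11/13)"
      by (simp add: powr_add [symmetric])
    also have "\<dots> \<le> real t * real k" using low by (intro mult_mono) auto
    finally show ?thesis .
  qed
  \<comment> \<open>With n * L \<le> 4 * m * k and S = t * k, the constant is 2 * 24 * 4 * 2 =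
    384.\<close>
  have "real (2 * m * t * (8 * 3 * (n * L) * (2 * m) div S\<^sup>2))
      \<le> 2 * m * t * (real (8 * 3 * (n * L) * (2 * m)) / (real S)\<^sup>2)"
    using mult_left_mono[OF of_nat_div_le_of_nat[of "8 * 3 * (n * L) * (2 * m)" "S\<^sup>2", where 'a = real]
        of_nat_0_le_iff[of "2 * m * t"]]
    by (simp only: of_nat_mult of_nat_power of_nat_numeral)
  also have "\<dots> \<le> 2 * m * t * (real (8 * 3 * (4 * m * k) * (2 * m)) / (real S)\<^sup>2)"
    by (intro mult_left_mono divide_right_mono of_nat_mono mult_right_mono[OF mult_left_mono[OF nL]]) auto
  also have "\<dots> = 384 * real m ^ 3 / (real t * real k)"
    using t k by (simp add: S_def power2_eq_square power3_eq_cube field_simps)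
  also have "\<dots> \<le> 384 * real m ^ 3 / real m powr (15/13)"
    using tk m t k by (intro divide_left_mono) auto
  also have "\<dots> = 384 * real m powr (24/13)"
    using m powr_diff[of "real m" 3 "15/13"] by (simp add: powr_numeral)
  finally have B: "real (2 * m * t * (8 * 3 * (n * L) * (2 * m) div S\<^sup>2)) \<le> 384 * real m powr (24/13)" .
  have "real (2 * (n * L) + 2 * m * t * (8 * 3 * (n * L) * (2 * m) div S\<^sup>2))
     = 2 * real (n * L) + real (2 * m * t * (8 * 3 * (n * L) * (2 * m) div S\<^sup>2))"
    by (simp only: of_nat_add of_nat_mult of_nat_numeral)
  also have "\<dots> \<le> 2 * (8 * real m powr (24/13)) + 384 * real m powr (24/13)"
    using A B by linarith
  also have "\<dots> \<le> 400 * real m powr (24/13)" by simp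
  finally show ?thesis .
qed

theorem theorem3p7:
  shows "\<exists>c::real. ((\<lambda>m::nat.
            real (card {\<sigma>. \<sigma> permutes {1..m} \<and>
                 real (ord_ramsey_K3 (2 * m) (icn2_matching m \<sigma>)) \<le> c * real m powr (24 / 13)})
            / fact m) \<longlongrightarrow> 1) sequentially"
proof -
  \<comment> \<open>The exponents satisfy t * k^2 = m^2, which balances the two kinds of room, while
    t^6 = m^(24/13) stays below m^2, as the first moment bound requires. Ceilings make the lower
    bounds exact; the upper bounds cost a factor 2.\<close>
  define t where "t m = nat \<lceil>real m powr (4/13)\<rceil>" for m
  define k where "k m = nat \<lceil>real m powr (11/13)\<rceil>" for m
  define good where "good m = {\<sigma>. \<sigma> permutes {1..m} \<and>
      real (ord_ramsey_K3 (2 * m) (icn2_matching m \<sigma>)) \<le> 400 * real m powr (24 / 13)}" for m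
  have ev_t: "eventually (\<lambda>m. real (t m) \<le> 2 * real m powr (4/13)) sequentially"
    unfolding t_def by real_asymp
  have ev_tm: "eventually (\<lambda>m. 2 * real m powr (4/13) \<le> m) sequentially"
    by real_asymp
  have ev_k: "eventually (\<lambda>m. real (k m) \<le> 2 * real m powr (11/13)) sequentially"
    unfolding k_def by real_asymp
  \<comment> \<open>For C = 3 and D = 2 * m the exponent is S / (16 * m), and S is at least
    m^(15/13).\<close>
  have ev_tail: "eventually (\<lambda>m. (real m + 1) * exp (- (real m powr (2/13) / 16)) < 1) sequentially"
    by real_asymp
  \<comment> \<open>The subtracted term bounds the probability of not being spread. It tends to 0 as
    50/13 < 4; with C = 2 the same count would be of order m^(3/13), hence the choice C = 3.\<close>
  have ev: "eventually (\<lambda>m. 1 - 256 * real m powr (50/13) / (real m - 4) ^ 4 \<le> real (card (good m)) / fact m)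
      sequentially"
    using ev_t ev_tm ev_k ev_tail eventually_gt_at_top[of 4]
  proof eventually_elim
    case (elim m)
    have m: "1 \<le> m" and t1: "real m powr (4/13) \<le> t m" and k1: "real m powr (11/13) \<le> k m"
      using elim by (auto simp: t_def k_def le_nat_iff real_nat_ceiling_ge)
    have "real m powr (4/13) > 0" "real m powr (11/13) > 0" using m by auto
    then have t0: "1 \<le> t m" and k0: "1 \<le> k m" using t1 k1 by (auto simp: Suc_le_eq intro: gr0I)
    have tm: "t m \<le> m" using elim(1,2) by linarith
    define n S where "n = m div t m + 1" and "S = t m * k m"
    have "n * t m \<le> m + t m" by (simp add: n_def algebra_simps)
    then have nt: "n * t m \<le> 2 * m" using tm by linarith
    have "real m powr (2/13) * real m = real m powr (4/13) * real m powr (11/13)"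
      using m powr_add[of "real m" "2/13" 1] by (simp add: powr_add [symmetric])
    also have "\<dots> \<le> real S"
      unfolding S_def of_nat_mult using t1 k1 by (intro mult_mono) auto
    finally have "real m powr (2/13) / 16 \<le> 3 * real S / (8 * (real 3 * real (2 * m)))"
      using m by (simp add: field_simps)
    moreover have "n \<le> m + 1" by (simp add: n_def)
    ultimately have "real n * exp (- (3 * real S / (8 * (real 3 * real (2 * m)))))
        \<le> (real m + 1) * exp (- (real m powr (2/13) / 16))"
      by (intro mult_mono) auto
    then have tail: "real n * exp (- (3 * real S / (8 * (real 3 * real (2 * m))))) < 1"
      using elim(4) by linarith
    define bad where "bad = {\<sigma>. \<sigma> permutes {1..m} \<and> \<not> spread 3 (t m) m \<sigma>}"
    have "\<sigma> \<in> good m" if \<sigma>: "\<sigma> permutes {1..m}" "spread 3 (t m) m \<sigma>" for \<sigma>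
    proof -
      have "ord_ramsey_K3 (2 * m) (icn2_matching m \<sigma>) \<le> 2 * (n * (t m + S))
          + 2 * m * t m * (8 * 3 * (n * (t m + S)) * (2 * m) div S\<^sup>2)"
        unfolding n_def
        by (rule ord_ramsey_icn2_matching_le[OF \<sigma>])
          (use m t0 k0 tail in \<open>auto simp: S_def n_def\<close>)
      then have "real (ord_ramsey_K3 (2 * m) (icn2_matching m \<sigma>)) \<le> real (2 * (n * (t m + S))
          + 2 * m * t m * (8 * 3 * (n * (t m + S)) * (2 * m) div S\<^sup>2))"
        by (rule of_nat_mono)
      also have "\<dots> \<le> 400 * real m powr (24 / 13)"
        unfolding n_def S_def by (rule placement_length_bound) (fact m t0 tm k0 t1 k1 elim(3))+
      finally show ?thesis using \<sigma> by (simp add: good_def)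
    qed
    then have "{\<sigma>. \<sigma> permutes {1..m}} \<subseteq> good m \<union> bad" by (auto simp: bad_def)
    moreover have "finite (good m \<union> bad)"
      by (rule finite_subset[OF _ finite_permutations[of "{1..m}"]]) (auto simp: good_def bad_def)
    ultimately have "card {\<sigma>. \<sigma> permutes {1..m}} \<le> card (good m \<union> bad)"
      by (intro card_mono)
    also have "\<dots> \<le> card (good m) + card bad" by (rule card_Un_le)
    finally have "fact m \<le> card (good m) + card bad" by (simp add: card_permutations)
    then have "real (fact m) \<le> real (card (good m) + card bad)" by (rule of_nat_mono)
    then have "1 \<le> (real (card (good m)) + real (card bad)) / fact m"
      by (simp add: le_divide_eq)
    then have good_ge: "1 - real (card bad) / fact m \<le> real (card (good m)) / fact m"
      by (simp add: add_divide_distrib)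
    have "real (n\<^sup>2 * t m ^ 8) = real (n * t m) ^ 2 * real (t m) ^ 6"
      \<comment> \<open>Two factors t are absorbed by n * t \<le> 2 * m, leaving t^6.\<close>
      by (simp add: power2_eq_square flip: power_add) (simp add: eval_nat_numeral)
    also have "\<dots> \<le> real (2 * m) ^ 2 * (2 * real m powr (4/13)) ^ 6"
      by (intro mult_mono[OF power_mono[OF of_nat_mono[OF nt]] power_mono[OF elim(1)]]) auto
    also have "\<dots> = 256 * (real m ^ 2 * (real m powr (4/13)) ^ 6)"
      by (simp add: power_mult_distrib)
    also have "real m ^ 2 * (real m powr (4/13)) ^ 6 = real m powr 2 * real m powr (24/13)"
      using m by (simp add: powr_power powr_numeral)
    also have "\<dots> = real m powr (50/13)"
      unfolding powr_add [symmetric] by simp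
    finally have nt8: "real (n\<^sup>2 * t m ^ 8) \<le> 256 * real m powr (50/13)" .
    have fact_ge: "(real m - 4) ^ 4 * fact (m - 4) \<le> fact m"
      using of_nat_mono[OF power_mult_fact_le_fact[of "m - 4" 4], where 'a = real] elim(5)
      by (simp add: of_nat_diff)
    have "card bad \<le> n\<^sup>2 * t m ^ 8 * fact (m - 4)"
      using card_not_spread_le[of "t m" m 3] t0 by (simp add: bad_def n_def)
    then have "real (card bad) \<le> real (n\<^sup>2 * t m ^ 8 * fact (m - 4))" by (rule of_nat_mono)
    also have "\<dots> = real (n\<^sup>2 * t m ^ 8) * fact (m - 4)" by simp
    also have "\<dots> \<le> 256 * real m powr (50/13) * fact (m - 4)"
      by (intro mult_right_mono nt8) simp
    finally have "real (card bad) / fact m \<le> 256 * real m powr (50/13) * fact (m - 4) / fact m"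
      by (rule divide_right_mono) simp
    also have "\<dots> \<le> 256 * real m powr (50/13) * fact (m - 4) / ((real m - 4) ^ 4 * fact (m - 4))"
      using fact_ge elim(5) by (intro divide_left_mono) auto
    also have "\<dots> = 256 * real m powr (50/13) / (real m - 4) ^ 4" by simp
    finally show ?case using good_ge by linarith
  qed
  have lim: "(\<lambda>m. 1 - 256 * real m powr (50/13) / (real m - 4) ^ 4) \<longlonglongrightarrow> 1"
    by real_asymp
  have le_1: "real (card (good m)) / fact m \<le> 1" for m
  proof -
    have "card (good m) \<le> card {\<sigma>. \<sigma> permutes {1..m}}"
      by (intro card_mono finite_permutations) (auto simp: good_def)
    also have "\<dots> = fact m" by (simp add: card_permutations)
    finally have "real (card (good m)) \<le> real (fact m)" by (rule of_nat_mono)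
    then show ?thesis by simp
  qed
  have "(\<lambda>m. real (card (good m)) / fact m) \<longlonglongrightarrow> 1"
    by (rule tendsto_sandwich[OF ev _ lim tendsto_const]) (simp add: le_1)
  then show ?thesis unfolding good_def by blast
qed

end
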